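(* With $C_n(x)=A_n(x)/B_n(x)$, the AIM asymptotic condition $$\lim_{n\to\infty}\left[C_n(x)-C_{n-1}(x)\right]=0\quad\text{for all }x\in I$$ becomes $$\lim_{n\to\infty}\frac{(-1)^n\prod_{j=0}^{n}q_j(x)}{B_n(x)B_{n-1}(x)}=0\quad\text{for all }x\in I.$$
   Context: Let $I\subseteq\mathbb{R}$ be an interval and $\lambda_0,s_0\in C^\infty(I)$, with $\lambda_0(x)\neq 0$ for all $x\in I$; these are the coefficients of the ODE $y''=\lambda_0 y'+s_0 y$, to which the asymptotic iteration method (AIM) is applied. Functions $p_n,q_n$: $p_0=\lambda_0$, $q_0=s_0$, and for $n\ge1$ $$p_n=p_{n-1}+\frac{q_{n-1}'}{q_{n-1}},\qquad q_n=q_{n-1}+p_{n-1}'-p_{n-1}\frac{q_{n-1}'}{q_{n-1}}.$$ $C_n=A_n/B_n$ is the $n$-th approximant of the continued fraction $$\cfrac{q_0(x)}{p_0(x)+\cfrac{q_1(x)}{p_1(x)+\cfrac{q_2(x)}{p_2(x)+\cdots}}},$$ that is, its truncation ending with $q_n(x)/p_n(x)$. The partial numerators $A_n$ and partial denominators $B_n$ satisfy, for all $n\ge 0$, $A_n=p_nA_{n-1}+q_nA_{n-2}$ with $A_{-1}=0$, $A_{-2}=1$, and $B_n=p_nB_{n-1}+q_nB_{n-2}$ with $B_{-1}=1$, $B_{-2}=0$. It is assumed throughout that $A_n/B_n$ is in reduced form, i.e. $A_n$ and $B_n$ have no common factors. *)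

theory Defs
  imports "HOL-Analysis.Analysis"
begin

text \<open>Derivatives are taken within I, so that they are one-sided at an end point belonging to I.\<close>

definition deriv_in :: "real set \<Rightarrow> (real \<Rightarrow> real) \<Rightarrow> real \<Rightarrow> real" where
  "deriv_in I f = (\<lambda>x. vector_derivative f (at x within I))"

definition smooth_in :: "real set \<Rightarrow> (real \<Rightarrow> real) \<Rightarrow> bool" where
  "smooth_in I f \<longleftrightarrow> (\<forall>k. (deriv_in I ^^ k) f differentiable_on I)"

text \<open>No common factors in the ring of smooth functions on I, whose units are the smooth
  functions without zeros in I.\<close>

definition no_common_factor :: "real set \<Rightarrow> (real \<Rightarrow> real) \<Rightarrow> (real \<Rightarrow> real) \<Rightarrow> bool" where
  "no_common_factor I f g \<longleftrightarrow>
     (\<forall>d a b. smooth_in I d \<and> smooth_in I a \<and> smooth_in I b \<and>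
        (\<forall>x\<in>I. f x = d x * a x) \<and> (\<forall>x\<in>I. g x = d x * b x) \<longrightarrow> (\<forall>x\<in>I. d x \<noteq> 0))"

text \<open>The recursion is meaningful as long as the functions \<open>aim_q\<close> have no zeros in I; at a zero
  the quotient takes the value 0 by the convention for division.\<close>

fun aim_p aim_q ::
  "real set \<Rightarrow> (real \<Rightarrow> real) \<Rightarrow> (real \<Rightarrow> real) \<Rightarrow> nat \<Rightarrow> real \<Rightarrow> real" where
  "aim_p I l s 0 = l"
| "aim_p I l s (Suc n) =
     (\<lambda>x. aim_p I l s n x + deriv_in I (aim_q I l s n) x / aim_q I l s n x)"
| "aim_q I l s 0 = s"
| "aim_q I l s (Suc n) =
     (\<lambda>x. aim_q I l s n x + deriv_in I (aim_p I l s n) x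
            - aim_p I l s n x * (deriv_in I (aim_q I l s n) x / aim_q I l s n x))"

text \<open>\<open>cf_rec p q a b\<close> is the solution of \<open>X n = p n * X (n - 1) + q n * X (n - 2)\<close>, for all
  n from 0 on, with \<open>X (-2) = a\<close> and \<open>X (-1) = b\<close>; its argument is shifted by 2.\<close>

fun cf_rec :: "(nat \<Rightarrow> real) \<Rightarrow> (nat \<Rightarrow> real) \<Rightarrow> real \<Rightarrow> real \<Rightarrow> nat \<Rightarrow> real" where
  "cf_rec p q a b 0 = a"
| "cf_rec p q a b (Suc 0) = b"
| "cf_rec p q a b (Suc (Suc n)) = p n * cf_rec p q a b (Suc n) + q n * cf_rec p q a b n"

text \<open>The integer index below is the mathematical one and ranges over the integers from -2 on.\<close>

definition aim_A :: "real set \<Rightarrow> (real \<Rightarrow> real) \<Rightarrow> (real \<Rightarrow> real) \<Rightarrow> int \<Rightarrow> real \<Rightarrow> real" where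
  "aim_A I l s n x = cf_rec (\<lambda>k. aim_p I l s k x) (\<lambda>k. aim_q I l s k x) 1 0 (nat (n + 2))"

definition aim_B :: "real set \<Rightarrow> (real \<Rightarrow> real) \<Rightarrow> (real \<Rightarrow> real) \<Rightarrow> int \<Rightarrow> real \<Rightarrow> real" where
  "aim_B I l s n x = cf_rec (\<lambda>k. aim_p I l s k x) (\<lambda>k. aim_q I l s k x) 0 1 (nat (n + 2))"

definition aim_C :: "real set \<Rightarrow> (real \<Rightarrow> real) \<Rightarrow> (real \<Rightarrow> real) \<Rightarrow> int \<Rightarrow> real \<Rightarrow> real" where
  "aim_C I l s n x = aim_A I l s n x / aim_B I l s n x"

end

theory Submission
  imports Defs
begin

text \<open>The determinant \<open>A n * B (n - 1) - A (n - 1) * B n\<close> gets multiplied by \<open>- q n\<close> in each step of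
  the recursion, so dividing it by \<open>B n * B (n - 1)\<close> shows that, as soon as the denominators no
  longer vanish, the two sequences coincide.\<close>

lemma cf_rec_determinant:
  "cf_rec p q 1 0 (Suc m) * cf_rec p q 0 1 m - cf_rec p q 1 0 m * cf_rec p q 0 1 (Suc m)
     = - ((-1) ^ m * (\<Prod>j<m. q j))"
proof (induction m)
  case (Suc m)
  \<comment> \<open>Unfolding the recursion, the terms with \<open>p m\<close> cancel; what is left
    is \<open>q m\<close> times the old determinant with its two products exchanged, hence the
    sign.\<close>
  have "cf_rec p q 1 0 (Suc (Suc m)) * cf_rec p q 0 1 (Suc m)
          - cf_rec p q 1 0 (Suc m) * cf_rec p q 0 1 (Suc (Suc m))
        = - q m * (cf_rec p q 1 0 (Suc m) * cf_rec p q 0 1 m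
                     - cf_rec p q 1 0 m * cf_rec p q 0 1 (Suc m))"
    by (simp add: algebra_simps)
  then show ?case
    by (simp only: Suc.IH) simp
\<comment> \<open>The start values give 0 * 0 - 1 * 1 = -1, the source of the leading minus.\<close>
qed simp

text \<open>Where a denominator vanishes, division by 0 makes the right side 0, but the left side
  need not be 0.\<close>

lemma aim_C_diff:
  assumes "aim_B I l s (int n) x \<noteq> 0" and "aim_B I l s (int n - 1) x \<noteq> 0"
  shows "aim_C I l s (int n) x - aim_C I l s (int n - 1) x
           = (-1) ^ n * (\<Prod>j=0..n. aim_q I l s j x)
               / (aim_B I l s (int n) x * aim_B I l s (int n - 1) x)"
proof -
  have idx: "nat (int n + 2) = Suc (Suc n)" "nat (int n - 1 + 2) = Suc n"
    by auto
  have "aim_A I l s (int n) x * aim_B I l s (int n - 1) x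
          - aim_A I l s (int n - 1) x * aim_B I l s (int n) x
        = (-1) ^ n * (\<Prod>j=0..n. aim_q I l s j x)"
    \<comment> \<open>By the index shift, this is the determinant at \<open>m = Suc n\<close>: its
      two minus signs leave \<open>(-1) ^ n\<close>, and \<open>j < Suc n\<close> is the range
      \<open>0..n\<close>.\<close>
    unfolding aim_A_def aim_B_def idx cf_rec_determinant
    by (simp add: atLeast0AtMost lessThan_Suc_atMost del: prod.lessThan_Suc)
  with assms show ?thesis
    by (simp add: aim_C_def diff_frac_eq)
qed

theorem mainTheorem6:
  fixes I :: "real set" and l0 s0 :: "real \<Rightarrow> real"
  assumes "is_interval I" and "interior I \<noteq> {}"
    and "smooth_in I l0" and "smooth_in I s0"
    and "\<forall>x\<in>I. l0 x \<noteq> 0"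
    and reduced: "\<forall>n::nat. no_common_factor I (aim_A I l0 s0 (int n)) (aim_B I l0 s0 (int n))"
    and defined: "\<forall>x\<in>I. \<forall>\<^sub>F n::nat in sequentially. aim_B I l0 s0 (int n) x \<noteq> 0"
  shows "(\<forall>x\<in>I. (\<lambda>n::nat. aim_C I l0 s0 (int n) x - aim_C I l0 s0 (int n - 1) x)
             \<longlonglongrightarrow> 0)
    \<longleftrightarrow> (\<forall>x\<in>I. (\<lambda>n::nat. (-1) ^ n * (\<Prod>j=0..n. aim_q I l0 s0 j x)
               / (aim_B I l0 s0 (int n) x * aim_B I l0 s0 (int n - 1) x))
             \<longlonglongrightarrow> 0)"
proof (intro ball_cong refl tendsto_cong)
  fix x assume "x \<in> I"
  with defined obtain N where N: "\<And>n. n \<ge> N \<Longrightarrow> aim_B I l0 s0 (int n) x \<noteq> 0"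
    by (auto simp: eventually_sequentially)
  show "\<forall>\<^sub>F n in sequentially. aim_C I l0 s0 (int n) x - aim_C I l0 s0 (int n - 1) x
          = (-1) ^ n * (\<Prod>j=0..n. aim_q I l0 s0 j x)
              / (aim_B I l0 s0 (int n) x * aim_B I l0 s0 (int n - 1) x)"
    \<comment> \<open>From \<open>Suc N\<close> on, both \<open>n\<close> and \<open>n - 1\<close>
      are at least \<open>N\<close>, and \<open>n\<close> is positive, so that
      \<open>int (n - 1) = int n - 1\<close>.\<close>
    using eventually_ge_at_top[of "Suc N"]
  proof eventually_elim
    case (elim n)
    then show ?case
      using N[of n] N[of "n - 1"] by (intro aim_C_diff) (auto simp: of_nat_diff)
  qed
qed

end
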